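(* Let $r \in \{2, 3\}$ and let $n_1$ be an integer with $n_1 \geq \frac{3}{r-1}$. Let $a(n_1) = r n_1$, and for integers $n > n_1$ let \[ a(n) = a(n-1) + \gcd(n, a(n-1)) \] and $g(n) = a(n) - a(n-1)$. Let $n_2$ be the smallest integer greater than $n_1$ such that $g(n_2) \neq 1$. Let $p$ be the smallest prime divisor of $a(n_1) - (n_1 + 1) = (r-1) n_1 - 1$. Then (a) $n_2 = n_1 + \frac{p-1}{r-1}$, (b) $g(n_2) = p$, and (c) $a(n_2) = r n_2$.
   Context: The existence of $n_2$ is part of what is asserted: the set of integers $n > n_1$ with $g(n) \neq 1$ is nonempty and $n_2$ is its minimum. The hypothesis $n_1 \geq \frac{3}{r-1}$ gives $(r-1)n_1 - 1 \geq 2$, so $p$ exists. *)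

theory Defs
  imports Complex_Main "HOL-Computational_Algebra.Primes"
begin

end

theory Submission
  imports Defs
begin

text \<open>
  Write \<open>D = (r - 1) n\<^sub>1 - 1\<close>. As long as every increment has been 1, the sequence is explicit:
  \<open>a (n\<^sub>1 + k) = r n\<^sub>1 + k\<close>. The difference between the two arguments of the next gcd is then
  constantly \<open>D\<close>, so the increment at \<open>n = n\<^sub>1 + k\<close> is \<open>gcd n D\<close>. Since \<open>D\<close> is coprime to
  \<open>r - 1\<close>, multiplying \<open>n\<close> by \<open>r - 1\<close> does not change this gcd, and
  \<open>(r - 1) n = D + ((r - 1) k + 1)\<close>; hence the increment equals \<open>gcd ((r - 1) k + 1) D\<close>
  (\<open>gcd_along_unit_increments\<close>).

  A number below the smallest prime divisor \<open>p\<close> of \<open>D\<close> is coprime to \<open>D\<close>. So the increments stay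
  1 while \<open>(r - 1) k + 1 < p\<close>, and the first other increment is \<open>gcd p D = p\<close>, at the \<open>k\<close> for
  which \<open>(r - 1) k + 1\<close> is equal to \<open>p\<close>. Such a \<open>k\<close> exists when \<open>r - 1\<close> divides \<open>p - 1\<close>. This is
  where \<open>r \<in> {2, 3}\<close> enters: it is trivial for \<open>r = 2\<close>, and for \<open>r = 3\<close> the number \<open>D\<close> is odd,
  hence so is \<open>p\<close>. At that index the value of \<open>a\<close> is
  \<open>r n\<^sub>1 + (k - 1) + p = r n\<^sub>1 + r k\<close>, so the ratio \<open>a n / n\<close> returns to \<open>r\<close>.
\<close>

lemma Least_prime_divisor:
  fixes D p :: int
  assumes D: "D \<ge> 2" and p: "p = (LEAST q. prime q \<and> q dvd D)"
  shows "prime p" "p dvd D" "\<And>q. prime q \<Longrightarrow> q dvd D \<Longrightarrow> p \<le> q"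
proof -
  \<comment> \<open>The integers are not well-ordered, so the least element is obtained as the minimum of the
    finite set of prime divisors.\<close>
  let ?P = "{q. prime q \<and> q dvd D}"
  have "\<exists>q. prime q \<and> q dvd D"
    using prime_divisor_exists[of D] D by auto
  moreover have fin: "finite ?P"
  proof (rule finite_subset)
    show "?P \<subseteq> {1..D}"
      using D by (auto simp: zdvd_imp_le dest: prime_ge_1_int)
  qed simp
  ultimately have "p = Min ?P" "?P \<noteq> {}"
    using p Least_Min[of "\<lambda>q. prime q \<and> q dvd D"] by auto
  with fin have "p \<in> ?P" and le: "\<forall>q\<in>?P. p \<le> q"
    using Min_in[of ?P] by auto
  then show "prime p" "p dvd D" by auto
  show "p \<le> q" if "prime q" "q dvd D" for q
    using le that by auto
qed

lemma coprime_below_least_prime_divisor: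
  fixes m D p :: int
  assumes least: "\<And>q. prime q \<Longrightarrow> q dvd D \<Longrightarrow> p \<le> q"
    and m: "0 < m" "m < p"
  shows "coprime m D"
proof (rule ccontr)
  assume "\<not> coprime m D"
  then have "\<not> is_unit (gcd m D)"
    by (simp add: coprime_iff_gcd_eq_1)
  moreover have "gcd m D \<noteq> 0"
    using m by simp
  ultimately obtain q where "prime q" "q dvd gcd m D"
    using prime_divisor_exists by blast
  then have "q \<le> m" "p \<le> q"
    using least m by (auto intro: zdvd_imp_le)
  with m show False by simp
qed

text \<open>The identity rests on \<open>(r - 1) * n - 1\<close> being coprime to \<open>r - 1\<close>, which allows \<open>n + k\<close> to be
  replaced by \<open>(r - 1) * (n + k)\<close> inside the gcd.\<close>
lemma gcd_along_unit_increments: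
  fixes r n k :: int
  shows "gcd (n + k) (r * n + k - 1) = gcd ((r - 1) * k + 1) ((r - 1) * n - 1)"
proof -
  define D where "D = (r - 1) * n - 1"
  have "is_unit c" if "c dvd D" "c dvd r - 1" for c
  proof -
    have "c dvd (r - 1) * n - D"
      by (rule dvd_diff[OF dvd_mult2[OF that(2)] that(1)])
    then show ?thesis by (simp add: D_def)
  qed
  then have coprime: "coprime D (r - 1)"
    by (rule coprimeI)
  have "gcd (n + k) (r * n + k - 1) = gcd (n + k) ((n + k) + D)"
    by (simp add: D_def algebra_simps)
  also have "\<dots> = gcd (n + k) D"
    by (rule gcd_add2)
  also have "\<dots> = gcd ((r - 1) * (n + k)) D"
    by (rule gcd_mult_left_left_cancel[OF coprime, symmetric])
  also have "(r - 1) * (n + k) = ((r - 1) * k + 1) + D"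
    by (simp add: D_def algebra_simps)
  also have "gcd (((r - 1) * k + 1) + D) D = gcd ((r - 1) * k + 1) D"
    by (rule gcd_add1)
  finally show ?thesis
    by (simp only: D_def)
qed

text \<open>The index \<open>k\<close> enters through \<open>p = (r - 1) * k + 1\<close>, so that the result covers every \<open>r > 1\<close>
  for which \<open>r - 1\<close> divides \<open>p - 1\<close>. The explicit form \<open>a (n\<^sub>1 + i) = r * n\<^sub>1 + i\<close> and the triviality
  of the gcds below \<open>k\<close> sustain each other by induction.\<close>
lemma first_nonunit_increment:
  fixes r n\<^sub>1 p k :: int and a :: "int \<Rightarrow> int"
  assumes r: "r > 1"
    and a_init: "a n\<^sub>1 = r * n\<^sub>1"
    and a_rec: "\<And>n. n > n\<^sub>1 \<Longrightarrow> a n = a (n - 1) + gcd n (a (n - 1))"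
    and p: "prime p" "p dvd (r - 1) * n\<^sub>1 - 1"
    and least: "\<And>q. prime q \<Longrightarrow> q dvd (r - 1) * n\<^sub>1 - 1 \<Longrightarrow> p \<le> q"
    and k: "p = (r - 1) * k + 1"
  shows "k > 0"
    and "\<And>n. n\<^sub>1 < n \<Longrightarrow> n < n\<^sub>1 + k \<Longrightarrow> a n - a (n - 1) = 1"
    and "a (n\<^sub>1 + k) - a (n\<^sub>1 + k - 1) = p"
    and "a (n\<^sub>1 + k) = r * (n\<^sub>1 + k)"
proof -
  have "(r - 1) * k > 0"
    using k prime_gt_1_int[OF p(1)] by simp
  then show k_pos: "k > 0"
    using r by (simp add: zero_less_mult_iff)
  have step: "a (n\<^sub>1 + j) = a (n\<^sub>1 + j - 1) + gcd ((r - 1) * j + 1) ((r - 1) * n\<^sub>1 - 1)"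
    if "j > 0" "a (n\<^sub>1 + j - 1) = r * n\<^sub>1 + j - 1" for j
    using a_rec[of "n\<^sub>1 + j"] that by (simp add: gcd_along_unit_increments)
  have unit: "gcd ((r - 1) * j + 1) ((r - 1) * n\<^sub>1 - 1) = 1" if "0 < j" "j < k" for j
  proof -
    have "(r - 1) * j < (r - 1) * k" "0 < (r - 1) * j"
      using r that by simp_all
    then show ?thesis
      using coprime_below_least_prime_divisor[OF least] k by (simp add: coprime_iff_gcd_eq_1)
  qed
  have explicit: "a (n\<^sub>1 + int i) = r * n\<^sub>1 + int i" if "int i < k" for i
    using that
  proof (induction i)
    case 0
    then show ?case by (simp add: a_init)
  next
    case (Suc i)
    then show ?case
      using step[of "int (Suc i)"] unit[of "int (Suc i)"] by simp
  qed
  have before: "a (n\<^sub>1 + j - 1) = r * n\<^sub>1 + j - 1" if "0 < j" "j \<le> k" for j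
    using explicit[of "nat (j - 1)"] that by (simp add: algebra_simps)
  show "a n - a (n - 1) = 1" if "n\<^sub>1 < n" "n < n\<^sub>1 + k" for n
    using step[of "n - n\<^sub>1"] unit[of "n - n\<^sub>1"] before[of "n - n\<^sub>1"] that by simp
  have "gcd p ((r - 1) * n\<^sub>1 - 1) = p"
    using p prime_gt_0_int[OF p(1)] by (simp add: gcd_proj1_iff)
  then have last: "a (n\<^sub>1 + k) = a (n\<^sub>1 + k - 1) + p"
    using step[of k] before[of k] k_pos by (simp add: k)
  then show "a (n\<^sub>1 + k) - a (n\<^sub>1 + k - 1) = p" by simp
  show "a (n\<^sub>1 + k) = r * (n\<^sub>1 + k)"
    using last before[of k] k_pos by (simp add: k algebra_simps)
qed

theorem mainTheorem2:
  fixes r n\<^sub>1 p :: int and a g :: "int \<Rightarrow> int"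
  assumes r: "r \<in> {2, 3}"
    and n1: "real_of_int n\<^sub>1 \<ge> 3 / (real_of_int r - 1)"
    and a_init: "a n\<^sub>1 = r * n\<^sub>1"
    and a_rec: "\<And>n. n > n\<^sub>1 \<Longrightarrow> a n = a (n - 1) + gcd n (a (n - 1))"
    and g: "\<And>n. n > n\<^sub>1 \<Longrightarrow> g n = a n - a (n - 1)"
    and p: "p = (LEAST q. prime q \<and> q dvd a n\<^sub>1 - (n\<^sub>1 + 1))"
  shows "\<exists>n\<^sub>2. (n\<^sub>2 > n\<^sub>1 \<and> g n\<^sub>2 \<noteq> 1) \<and> (\<forall>n. n > n\<^sub>1 \<and> g n \<noteq> 1 \<longrightarrow> n\<^sub>2 \<le> n)
    \<and> real_of_int n\<^sub>2 = real_of_int n\<^sub>1 + (real_of_int p - 1) / (real_of_int r - 1)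
    \<and> g n\<^sub>2 = p
    \<and> a n\<^sub>2 = r * n\<^sub>2"
proof -
  have r_gt: "r > 1" using r by auto
  have D_eq: "a n\<^sub>1 - (n\<^sub>1 + 1) = (r - 1) * n\<^sub>1 - 1"
    by (simp add: a_init algebra_simps)
  have "3 \<le> (real_of_int r - 1) * real_of_int n\<^sub>1"
    using n1 r_gt by (simp add: field_simps)
  then have "real_of_int 3 \<le> real_of_int ((r - 1) * n\<^sub>1)" by simp
  then have "3 \<le> (r - 1) * n\<^sub>1" by (simp only: of_int_le_iff)
  then have D_ge: "(r - 1) * n\<^sub>1 - 1 \<ge> 2" by simp
  note p_least = Least_prime_divisor[OF D_ge p[unfolded D_eq]]
  have "r - 1 dvd p - 1"
  proof (cases "r = 3")
    case True
    then have "odd ((r - 1) * n\<^sub>1 - 1)" by simp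
    then have "odd p" using p_least(2) dvd_trans by blast
    then show ?thesis using True by simp
  next
    case False
    then show ?thesis using r by simp
  qed
  then obtain k where "p - 1 = (r - 1) * k" by (rule dvdE)
  then have k: "p = (r - 1) * k + 1" by simp
  note inc = first_nonunit_increment[OF r_gt a_init a_rec p_least k]
  have g_last: "g (n\<^sub>1 + k) = p"
    using g[of "n\<^sub>1 + k"] inc(1,3) by simp
  have "n\<^sub>1 + k > n\<^sub>1" "g (n\<^sub>1 + k) \<noteq> 1"
    using inc(1) g_last prime_gt_1_int[OF p_least(1)] by simp_all
  moreover have "\<forall>n. n > n\<^sub>1 \<and> g n \<noteq> 1 \<longrightarrow> n\<^sub>1 + k \<le> n"
  proof (intro allI impI, rule ccontr)
    fix n
    assume n: "n > n\<^sub>1 \<and> g n \<noteq> 1" and "\<not> n\<^sub>1 + k \<le> n"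
    then have "g n = 1" using g[of n] inc(2)[of n] by simp
    with n show False by blast
  qed
  moreover have "real_of_int (n\<^sub>1 + k)
      = real_of_int n\<^sub>1 + (real_of_int p - 1) / (real_of_int r - 1)"
    using r_gt by (simp add: k)
  ultimately show ?thesis
    using g_last inc(4) by blast
qed

end
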